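(* Let $m,n\geq1$ be integers with $m\geq n$, $m+n$ even, and $n$ even (so $m$ is even as well). Then $[u^m](u\cot u)^{m+1}=(-1)^{m/2}$. Consequently, in the expansion $$\int_0^\infty \frac{\tanh^{m+1}x}{x^{n+1}}\,dx = (-1)^{(m-n)/2}\sum_{p=n/2}^{(m+n)/2}\binom{2p}{n}(2^{2p+1}-1)\frac{\zeta(2p+1)}{\pi^{2p}}\,[u^{m+n-2p}](u\cot u)^{m+1},$$ the first summand, corresponding to $p=n/2$ (including the global sign $(-1)^{(m-n)/2}$), equals $$(-1)^{n/2}(2^{n+1}-1)\frac{\zeta(n+1)}{\pi^n};$$ in particular its coefficient is independent of $m$.
   Context: $\zeta$ is the Riemann zeta function. $[u^r]F(u)$ denotes the coefficient of $u^r$ in the expansion of $F$ at the origin; $u\cot u$ is extended holomorphically to $u=0$ with value $1$. *)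

theory Defs
  imports "HOL-Complex_Analysis.Complex_Analysis"
begin

(* The Dirichlet series defines the Riemann zeta function on the half-plane Re s > 1.
   The value is meaningless elsewhere (no analytic continuation); only arguments
   2 * p + 1 with p >= 1 are used. *)
definition riemann_zeta :: "complex \<Rightarrow> complex" where
  "riemann_zeta s = (\<Sum>k. 1 / of_nat (Suc k) powr s)"

definition u_cot :: "complex \<Rightarrow> complex" where
  "u_cot u = (if u = 0 then 1 else u * cot u)"

definition taylor_coeff :: "nat \<Rightarrow> (complex \<Rightarrow> complex) \<Rightarrow> complex" where
  "taylor_coeff r F = fps_nth (fps_expansion F 0) r"

(* The factor multiplying riemann_zeta (2 * p + 1) in the p-th summand, without the global sign. *)
definition summand_coeff :: "nat \<Rightarrow> nat \<Rightarrow> nat \<Rightarrow> complex" where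
  "summand_coeff m n p =
     of_nat (2 * p choose n) * (2 ^ (2 * p + 1) - 1) / of_real pi ^ (2 * p)
       * taylor_coeff (m + n - 2 * p) (\<lambda>u. u_cot u ^ (m + 1))"

definition summand :: "nat \<Rightarrow> nat \<Rightarrow> nat \<Rightarrow> complex" where
  "summand m n p = summand_coeff m n p * riemann_zeta (of_nat (2 * p + 1))"

end

theory Submission
  imports Defs
begin

text \<open>
  Integrate \<open>tan z ^ (m + 1) / z ^ (n + 1)\<close> over the boundary of the rectangle with
  \<open>0 \<le> Re z \<le> N\<pi>\<close> and \<open>\<bar>Im z\<bar> \<le> N\<pi>\<close>. On the imaginary axis the integrand is, up to sign,
  \<open>tanh x ^ (m + 1) / x ^ (n + 1)\<close>, while on the other three sides \<open>tan\<close> is bounded by 2, so that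
  they contribute \<open>O(1 / N ^ n)\<close>. The poles inside are \<open>\<pi>(k + 1/2)\<close>, where
  \<open>tan (\<pi>(k + 1/2) + w) = - cot w\<close>; expanding \<open>(\<pi>(k + 1/2) + w) powi (-n-1)\<close> in \<open>w\<close> expresses the
  residue through the coefficients of \<open>(w cot w) ^ (m + 1)\<close>, and summing over \<open>k\<close> produces
  the values \<open>(1 - 2 powi (-2p-1)) \<zeta>(2p+1)\<close>.

  For the diagonal coefficient, \<open>A(u) = u cot u\<close> satisfies \<open>u A' = A - u\<^sup>2 - A\<^sup>2\<close>; multiplying
  by \<open>A ^ (r + 1)\<close> and comparing coefficients of \<open>u ^ (r + 2)\<close> gives
  \<open>[u ^ (r + 2)] A ^ (r + 3) = - [u ^ r] A ^ (r + 1)\<close>.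
\<close>

subsection \<open>The power series of \<open>u cot u\<close>\<close>

text \<open>Both \<open>u * cos u\<close> and \<open>sin u\<close> have a simple zero at the origin
  with leading coefficient 1, so their quotient is analytic there with value 1, the value built into
  \<open>u_cot\<close>.\<close>

lemma u_cot_analytic: "u_cot analytic_on {0}"
proof -
  have "(\<lambda>x. if x = 0 then 1 else x * cos x / sin x) has_fps_expansion
          (fps_X * fps_cos 1) / fps_sin (1::complex)"
  proof (rule has_fps_expansion_divide)
    have S: "subdegree (fps_sin (1::complex)) = 1"
      by (rule subdegreeI) auto
    show "subdegree (fps_sin (1::complex)) \<le> subdegree (fps_X * fps_cos (1::complex))"
      unfolding S by (rule subdegree_geI) (auto simp: fps_eq_iff intro!: exI[of _ 1])
    show "1 = fps_nth (fps_X * fps_cos (1::complex)) (subdegree (fps_sin (1::complex))) /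
                fps_nth (fps_sin 1) (subdegree (fps_sin (1::complex)))"
      unfolding S by simp
    show "fps_sin (1::complex) \<noteq> 0"
      using S by auto
  qed (intro fps_expansion_intros)+
  also have "(\<lambda>x::complex. if x = 0 then 1 else x * cos x / sin x) = u_cot"
    by (auto simp: u_cot_def cot_def fun_eq_iff)
  finally show ?thesis
    by (rule has_fps_expansion_imp_analytic_0)
qed

definition ucot_fps :: "complex fps" where
  "ucot_fps = fps_expansion u_cot 0"

lemma u_cot_has_fps_expansion: "u_cot has_fps_expansion ucot_fps"
  unfolding ucot_fps_def by (intro analytic_at_imp_has_fps_expansion_0 u_cot_analytic)

lemma taylor_coeff_u_cot_power:
  "taylor_coeff r (\<lambda>u. u_cot u ^ k) = fps_nth (ucot_fps ^ k) r"
  unfolding taylor_coeff_def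
  by (subst fps_expansion_eqI[OF has_fps_expansion_power[OF u_cot_has_fps_expansion]]) simp

lemma eventually_sin_nonzero: "eventually (\<lambda>u::complex. u \<noteq> 0 \<longrightarrow> sin u \<noteq> 0) (nhds 0)"
proof -
  have "eventually (\<lambda>u::complex. u \<in> ball 0 pi) (nhds 0)"
    by (intro eventually_nhds_in_open) auto
  then show ?thesis
  proof eventually_elim
    case (elim u)
    show ?case
    proof (intro impI notI)
      assume "u \<noteq> 0" "sin u = 0"
      then obtain n :: int where n: "u = of_real (n * pi)" by (auto simp: sin_eq_0)
      with \<open>u \<noteq> 0\<close> have "\<bar>real_of_int n\<bar> \<ge> 1" by auto
      with elim show False by (simp add: n norm_mult)
    qed
  qed
qed

text \<open>The relation \<open>cot = cos / sin\<close> cleared of its denominator, so that it can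
  be differentiated by the product rule without dividing power series.\<close>

lemma ucot_fps_sin: "ucot_fps * fps_sin 1 = fps_X * fps_cos 1"
proof (rule fps_expansion_unique_complex)
  show "(\<lambda>u. u_cot u * sin u) has_fps_expansion ucot_fps * fps_sin 1"
    by (intro fps_expansion_intros u_cot_has_fps_expansion)
  have "(\<lambda>u::complex. u * cos u) has_fps_expansion fps_X * fps_cos 1"
    by (intro fps_expansion_intros)
  moreover have "eventually (\<lambda>u. u * cos u = u_cot u * sin u) (nhds 0)"
    using eventually_sin_nonzero by eventually_elim (auto simp: u_cot_def cot_def)
  ultimately show "(\<lambda>u. u_cot u * sin u) has_fps_expansion fps_X * fps_cos 1"
    by (subst (asm) has_fps_expansion_cong) auto
qed

lemma fps_sin_nonzero: "fps_sin (1::complex) \<noteq> 0"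
  by (metis fps_sin_nth_1 fps_zero_nth zero_neq_one)

text \<open>Differentiate \<open>ucot_fps_sin\<close>, multiply by \<open>fps_X\<close>, replace
  each \<open>fps_X * fps_cos 1\<close> by \<open>ucot_fps * fps_sin 1\<close>, and cancel the
  nonzero factor \<open>fps_sin 1\<close>.\<close>

lemma ucot_fps_ode: "fps_X * fps_deriv ucot_fps = ucot_fps - fps_X ^ 2 - ucot_fps ^ 2"
proof -
  let ?A = ucot_fps and ?S = "fps_sin (1::complex)" and ?C = "fps_cos (1::complex)"
  have "fps_deriv (?A * ?S) = fps_deriv (fps_X * ?C)"
    by (simp only: ucot_fps_sin)
  then have D: "fps_deriv ?A * ?S + ?A * ?C = ?C - fps_X * ?S"
    by (simp add: fps_sin_deriv fps_cos_deriv algebra_simps flip: fps_const_neg)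
  have "(fps_X * fps_deriv ?A) * ?S = fps_X * (fps_deriv ?A * ?S)"
    by (simp add: algebra_simps)
  also have "\<dots> = fps_X * ?C - fps_X ^ 2 * ?S - ?A * (fps_X * ?C)"
    using D by (simp add: algebra_simps power2_eq_square eq_diff_eq flip: distrib_left)
  also have "\<dots> = (?A - fps_X ^ 2 - ?A ^ 2) * ?S"
    unfolding ucot_fps_sin[symmetric] by (simp add: algebra_simps power2_eq_square)
  finally show ?thesis using fps_sin_nonzero by simp
qed

lemma ucot_fps_0: "fps_nth ucot_fps 0 = 1"
  using has_fps_expansion_imp_0_eq_fps_nth_0[OF u_cot_has_fps_expansion]
  by (simp add: u_cot_def)

lemma ucot_fps_power_nth_rec:
  "fps_nth (ucot_fps ^ (r + 3)) (r + 2) = - fps_nth (ucot_fps ^ (r + 1)) r"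
proof -
  let ?A = ucot_fps
  have "of_nat (r + 2) * ?A ^ (r + 3) = of_nat (r + 2) * ?A ^ (r + 1) * ?A ^ 2"
    by (simp add: power_add eval_nat_numeral algebra_simps)
  also have "?A ^ 2 = ?A - fps_X ^ 2 - fps_X * fps_deriv ?A"
    by (simp add: ucot_fps_ode)
  also have "of_nat (r + 2) * ?A ^ (r + 1) * \<dots> =
     of_nat (r + 2) * ?A ^ (r + 2) - of_nat (r + 2) * (fps_X ^ 2 * ?A ^ (r + 1))
       - fps_X * fps_deriv (?A ^ (r + 2))"
    by (subst fps_deriv_power') (simp add: algebra_simps)
  finally have "fps_nth (of_nat (r + 2) * ?A ^ (r + 3)) (r + 2) = fps_nth (\<dots>) (r + 2)"
    by simp
  \<comment> \<open>The Euler operator multiplies the coefficient of index \<open>r + 2\<close> by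
    \<open>r + 2\<close>, so this term cancels the contribution of \<open>?A ^ (r + 2)\<close>
    exactly.\<close>
  moreover have "fps_nth (fps_X * fps_deriv (?A ^ (r + 2))) (r + 2) =
      of_nat (r + 2) * fps_nth (?A ^ (r + 2)) (r + 2)"
    by (simp only: fps_X_mult_nth fps_deriv_nth) simp
  ultimately have "of_nat (r + 2) * fps_nth (?A ^ (r + 3)) (r + 2) =
      - (of_nat (r + 2) * fps_nth (?A ^ (r + 1)) r)"
    by (simp add: fps_X_power_mult_nth del: of_nat_add power_Suc flip: fps_of_nat)
  then have "(of_nat (r + 2) :: complex) * fps_nth (?A ^ (r + 3)) (r + 2) =
      of_nat (r + 2) * - fps_nth (?A ^ (r + 1)) r"
    by simp
  then show ?thesis
    by (subst (asm) mult_cancel_left) (simp only: of_nat_eq_0_iff, simp)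
qed

lemma ucot_fps_power_nth_diag: "fps_nth (ucot_fps ^ (2 * k + 1)) (2 * k) = (-1) ^ k"
proof (induction k)
  case 0
  then show ?case by (simp add: ucot_fps_0)
next
  case (Suc k)
  with ucot_fps_power_nth_rec[of "2 * k"] show ?case
    by (simp add: eval_nat_numeral)
qed

text \<open>Since \<open>u cot u\<close> is even, substituting \<open>- fps_X\<close> fixes the
  series, while it changes the sign of every odd coefficient.\<close>

lemma ucot_fps_power_nth_odd:
  assumes "odd r"
  shows "fps_nth (ucot_fps ^ k) r = 0"
proof -
  have "(u_cot \<circ> uminus) has_fps_expansion fps_compose ucot_fps (- fps_X)"
    by (intro fps_expansion_intros u_cot_has_fps_expansion) auto
  also have "u_cot \<circ> uminus = u_cot"
    by (auto simp: u_cot_def fun_eq_iff)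
  finally have "fps_compose ucot_fps (- fps_X) = ucot_fps"
    using u_cot_has_fps_expansion fps_expansion_unique_complex by blast
  then have "fps_compose (ucot_fps ^ k) (- fps_X) = ucot_fps ^ k"
    by (simp flip: fps_compose_power)
  then have "fps_nth (fps_compose (ucot_fps ^ k) (- fps_X)) r = fps_nth (ucot_fps ^ k) r"
    by simp
  then have "- fps_nth (ucot_fps ^ k) r = fps_nth (ucot_fps ^ k) r"
    using assms by (simp add: fps_compose_uminus')
  then show ?thesis by simp
qed

text \<open>The negative binomial series, after writing \<open>z + x = z * (1 - c * x)\<close> with
  \<open>c = - inverse z\<close>.\<close>

lemma inverse_shifted_power_fps:
  fixes z :: complex
  assumes "z \<noteq> 0"
  shows "(\<lambda>x. inverse ((z + x) ^ Suc n)) has_fps_expansion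
           Abs_fps (\<lambda>j. of_nat ((n + j) choose n) * (-1) ^ j / z ^ (n + j + 1))"
proof -
  define c where "c = - inverse z"
  have "(\<lambda>x. inverse (z ^ Suc n) * inverse ((1 - c * x) ^ Suc n)) has_fps_expansion
          fps_const (inverse (z ^ Suc n)) * inverse ((1 - fps_const c * fps_X) ^ Suc n)"
    by (intro fps_expansion_intros) (auto simp del: power_Suc)
  also have "(\<lambda>x. inverse (z ^ Suc n) * inverse ((1 - c * x) ^ Suc n)) = (\<lambda>x. inverse ((z + x) ^ Suc n))"
    using assms by (simp add: fun_eq_iff c_def field_simps flip: power_mult_distrib inverse_mult_distrib del: power_Suc)
  also have "fps_const (inverse (z ^ Suc n)) * inverse ((1 - fps_const c * fps_X) ^ Suc n) =
      Abs_fps (\<lambda>j. of_nat ((n + j) choose n) * (-1) ^ j / z ^ (n + j + 1))"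
    using assms binomial_symmetric[of n "n + j" for j]
    by (subst one_minus_const_fps_X_neg_power')
       (auto simp: fps_eq_iff c_def field_simps power_minus' power_add power_inverse)
  finally show ?thesis .
qed

subsection \<open>Residues at the poles of the tangent\<close>

lemma odd_zeta_sums:
  assumes "s \<ge> 2"
  shows "(\<lambda>k. 1 / of_nat (2 * k + 1) ^ s) sums ((1 - 1 / 2 ^ s) * riemann_zeta (of_nat s))"
proof -
  define f :: "nat \<Rightarrow> complex" where "f = (\<lambda>k. 1 / of_nat (Suc k) ^ s)"
  have "summable (\<lambda>k. inverse (of_nat k ^ s) :: complex)"
    using assms by (rule inverse_power_summable)
  then have "summable (\<lambda>k. inverse (of_nat (Suc k) ^ s) :: complex)"
    by (subst summable_Suc_iff)
  then have "summable f"
    by (simp add: f_def divide_inverse)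
  moreover have "riemann_zeta (of_nat s) = suminf f"
    unfolding riemann_zeta_def f_def by (intro suminf_cong) (subst powr_nat, simp del: of_nat_Suc)
  ultimately have f: "f sums riemann_zeta (of_nat s)"
    by (simp add: summable_sums)
  \<comment> \<open>Since \<open>f k\<close> has denominator base \<open>k + 1\<close>, each pair
    holds the odd base \<open>2 * k + 1\<close> and the even base \<open>2 * (k + 1)\<close>. The
    even term is \<open>f k / 2 ^ s\<close>, so subtracting it leaves the odd one.\<close>
  have "(\<lambda>k. sum f {k * 2..<k * 2 + 2}) sums riemann_zeta (of_nat s)"
    using f by (rule sums_group) simp
  moreover have "(\<lambda>k. 1 / 2 ^ s * f k) sums (1 / 2 ^ s * riemann_zeta (of_nat s))"
    using f by (rule sums_mult)
  ultimately have "(\<lambda>k. sum f {k * 2..<k * 2 + 2} - 1 / 2 ^ s * f k) sums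
      (riemann_zeta (of_nat s) - 1 / 2 ^ s * riemann_zeta (of_nat s))"
    by (rule sums_diff)
  moreover have "sum f {k * 2..<k * 2 + 2} - 1 / 2 ^ s * f k = 1 / of_nat (2 * k + 1) ^ s" for k
  proof -
    have "sum f {k * 2..<k * 2 + 2} = f (2 * k) + f (2 * k + 1)"
      by (simp add: eval_nat_numeral mult.commute)
    moreover have "f (2 * k + 1) = 1 / 2 ^ s * f k"
    proof -
      have "(of_nat (Suc (2 * k + 1)) :: complex) = 2 * of_nat (Suc k)" by simp
      then show ?thesis unfolding f_def by (simp only: power_mult_distrib) simp
    qed
    ultimately show ?thesis by (simp add: f_def)
  qed
  ultimately show ?thesis by (simp add: left_diff_distrib)
qed

definition tan_pole :: "nat \<Rightarrow> complex" where
  "tan_pole k = of_real (pi * (real k + 1 / 2))"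

text \<open>The poles are \<open>pi / 2\<close> times the odd positive integers, and the factor
  \<open>2 ^ s\<close> turns \<open>1 - 1 / 2 ^ s\<close> into \<open>2 ^ s - 1\<close> for
  \<open>s = 2 * p + 1\<close>.\<close>

lemma tan_pole_power_sums:
  assumes "p \<ge> 1"
  shows "(\<lambda>k. 1 / tan_pole k ^ (2 * p + 1)) sums
           ((2 ^ (2 * p + 1) - 1) * riemann_zeta (of_nat (2 * p + 1)) / of_real pi ^ (2 * p + 1))"
proof -
  let ?s = "2 * p + 1"
  have "1 / tan_pole k ^ ?s = 2 ^ ?s / of_real pi ^ ?s * (1 / of_nat (2 * k + 1) ^ ?s)" for k
  proof -
    have "tan_pole k = of_real pi / 2 * of_nat (2 * k + 1)"
      by (simp add: tan_pole_def algebra_simps)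
    then show ?thesis
      by (simp only: power_mult_distrib power_divide) simp
  qed
  moreover have "(\<lambda>k. 2 ^ ?s / of_real pi ^ ?s * (1 / of_nat (2 * k + 1) ^ ?s)) sums
      (2 ^ ?s / of_real pi ^ ?s * ((1 - 1 / 2 ^ ?s) * riemann_zeta (of_nat ?s)))"
    using assms by (intro sums_mult odd_zeta_sums) auto
  moreover have "2 ^ ?s / of_real pi ^ ?s * ((1 - 1 / 2 ^ ?s) * riemann_zeta (of_nat ?s)) =
      (2 ^ ?s - 1) * riemann_zeta (of_nat ?s) / of_real pi ^ ?s"
    by (simp add: field_simps del: of_nat_add of_nat_mult of_nat_Suc)
  ultimately show ?thesis by (simp only:)
qed

text \<open>Because \<open>n \<le> m\<close>, the integrand has no pole at the origin; factoring it through
  \<open>tan z / z\<close> gives it its removable value there.\<close>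

definition tan_quot :: "complex \<Rightarrow> complex" where
  "tan_quot z = (if z = 0 then 1 else tan z / z)"

lemma open_cos_nonzero: "open {z::complex. cos z \<noteq> 0}"
  by (intro open_Collect_neq continuous_intros)

text \<open>This is the difference quotient of \<open>tan\<close> at 0, completed by the derivative
  \<open>tan' 0 = 1\<close>; the singularity is removable.\<close>

lemma tan_quot_holomorphic: "tan_quot holomorphic_on {z. cos z \<noteq> 0}"
proof (rule pole_theorem_open_0[where g = tan and a = 0])
  show "tan holomorphic_on {z. cos z \<noteq> 0}"
    by (intro holomorphic_on_tan) auto
  have "deriv tan (0 :: complex) = 1"
    by (rule DERIV_imp_deriv) (auto intro!: derivative_eq_intros)
  then show "tan_quot 0 = deriv tan 0"
    by (simp add: tan_quot_def)
qed (auto simp: tan_quot_def open_cos_nonzero)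

definition integrand :: "nat \<Rightarrow> nat \<Rightarrow> complex \<Rightarrow> complex" where
  "integrand m n z = tan_quot z ^ (n + 1) * tan z ^ (m - n)"

lemma integrand_eq:
  assumes "z \<noteq> 0" "n \<le> m"
  shows "integrand m n z = tan z ^ (m + 1) / z ^ (n + 1)"
  using assms by (simp add: integrand_def tan_quot_def power_divide flip: power_add power_Suc)

lemma integrand_holomorphic: "integrand m n holomorphic_on {z. cos z \<noteq> 0}"
  unfolding integrand_def
  by (intro holomorphic_intros tan_quot_holomorphic holomorphic_on_tan) auto

text \<open>The Cauchy product formula for the coefficient of \<open>x ^ m\<close> in
  \<open>(x cot x) ^ (m + 1) / (z + x) ^ (n + 1)\<close>.\<close>

definition residue_sum :: "nat \<Rightarrow> nat \<Rightarrow> complex \<Rightarrow> complex" where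
  "residue_sum m n z = (\<Sum>j\<le>m. of_nat ((n + j) choose n) * (-1) ^ j / z ^ (n + j + 1) * 
     fps_nth (ucot_fps ^ (m + 1)) (m - j))"

lemma cos_tan_pole: "cos (tan_pole k) = 0"
  unfolding cos_eq_0 tan_pole_def by (rule exI[of _ "int k"]) (simp add: algebra_simps)

lemma tan_pole_nonzero: "tan_pole k \<noteq> 0"
  using cos_tan_pole[of k] by auto

text \<open>With \<open>cos\<close> zero at the pole, the addition formulas leave a common factor
  \<open>sin (tan_pole k)\<close>, which is nonzero. If \<open>sin x = 0\<close>, both sides are 0
  by the convention for division by zero.\<close>

lemma tan_shift_pole: "tan (tan_pole k + x) = - cot x"
proof -
  have "sin (tan_pole k) \<noteq> 0"
    using cos_tan_pole[of k] sin_cos_squared_add[of "tan_pole k"] by auto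
  then show ?thesis
    by (simp add: tan_def cot_def sin_add cos_add cos_tan_pole)
qed

text \<open>Moved to the origin, the integrand is a power series over \<open>x ^ (m + 1)\<close>, so
  its residue is the coefficient of index \<open>m\<close>. The minus sign is
  \<open>(-1) ^ (m + 1)\<close> for even \<open>m\<close>.\<close>

lemma residue_integrand:
  assumes "n \<le> m" "even m"
  shows "residue (integrand m n) (tan_pole k) = - residue_sum m n (tan_pole k)"
proof -
  let ?z = "tan_pole k"
  define F where "F = ucot_fps ^ (m + 1) *
    Abs_fps (\<lambda>j. of_nat ((n + j) choose n) * (-1) ^ j / ?z ^ (n + j + 1))"
  have F: "(\<lambda>x. u_cot x ^ (m + 1) * inverse ((?z + x) ^ Suc n)) has_fps_expansion F"
    unfolding F_def
    by (intro has_fps_expansion_mult has_fps_expansion_power u_cot_has_fps_expansion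
          inverse_shifted_power_fps tan_pole_nonzero)
  have "residue (integrand m n) ?z = residue (\<lambda>x. integrand m n (?z + x)) 0"
    by (rule residue_shift_0)
  also have "\<dots> = residue (\<lambda>x. (- (u_cot x ^ (m + 1) * inverse ((?z + x) ^ Suc n))) / x ^ Suc m) 0"
  proof (rule residue_cong)
    \<comment> \<open>Excluding \<open>- ?z\<close> keeps \<open>?z + x\<close> away from 0, where
      \<open>integrand_eq\<close> does not apply.\<close>
    have "eventually (\<lambda>x::complex. x \<in> - {- ?z} - {0}) (at 0)"
      using tan_pole_nonzero[of k] by (intro eventually_at_in_open) auto
    then show "eventually (\<lambda>x. integrand m n (?z + x) =
        (- (u_cot x ^ (m + 1) * inverse ((?z + x) ^ Suc n))) / x ^ Suc m) (at 0)"
    proof eventually_elim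
      case (elim x)
      then have "?z + x \<noteq> 0" by (auto simp: add_eq_0_iff2)
      then have "integrand m n (?z + x) = (- cot x) ^ (m + 1) / (?z + x) ^ (n + 1)"
        using assms by (subst integrand_eq) (simp_all add: tan_shift_pole)
      also have "(- cot x) ^ (m + 1) = - (u_cot x ^ (m + 1) / x ^ Suc m)"
        using assms elim by (simp add: u_cot_def power_mult_distrib)
      finally show ?case by (simp add: divide_inverse)
    qed
  qed simp
  also have "\<dots> = fps_nth (- F) m"
    by (intro residue_fps_expansion_over_power_at_0 has_fps_expansion_minus F)
  also have "\<dots> = - residue_sum m n ?z"
    unfolding F_def residue_sum_def
    by (subst mult.commute) (simp add: fps_mult_nth atLeast0AtMost)
  finally show ?thesis .
qed

text \<open>Here \<open>S\<close> is \<open>sinh (Im z) ^ 2\<close>, and the squared norms of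
  \<open>cos z\<close> and \<open>sin z\<close> are \<open>cos (Re z) ^ 2 + S\<close> and at most
  \<open>1 + S\<close>. Either the cosine term is 1 or \<open>S \<ge> 1\<close>, so the second is at
  most four times the first.\<close>

lemma norm_tan_le_2:
  assumes "cos (Re z) ^ 2 = 1 \<or> \<bar>Im z\<bar> \<ge> 2"
  shows "cos z \<noteq> 0" "norm (tan z) \<le> 2"
proof -
  define S where "S = (exp (Im z) - inverse (exp (Im z))) ^ 2 / 4"
  have c: "norm (cos z) ^ 2 = cos (Re z) ^ 2 + S"
    unfolding S_def by (rule norm_cos_squared)
  have "norm (sin z) ^ 2 = sin (Re z) ^ 2 + S"
    unfolding S_def norm_sin_squared cos_double sin_squared_eq
    by (simp add: power2_eq_square field_simps flip: exp_add)
  then have s: "norm (sin z) ^ 2 \<le> 1 + S"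
    by (simp add: abs_square_le_1)
  have "S \<ge> 0" by (simp add: S_def)
  have S: "S \<ge> 1" if "\<bar>Im z\<bar> \<ge> 2"
  proof -
    \<comment> \<open>From \<open>exp y \<ge> 1 + y \<ge> 3\<close> the difference is at least
      \<open>3 - 1/3\<close>, which exceeds 2.\<close>
    have *: "(exp y - inverse (exp y)) ^ 2 \<ge> 4" if "y \<ge> 2" for y :: real
    proof -
      have "exp y \<ge> 3" using exp_ge_add_one_self[of y] that by linarith
      moreover from this have "inverse (exp y) \<le> inverse 3" by (intro le_imp_inverse_le) auto
      ultimately have "exp y - inverse (exp y) \<ge> 2" by simp
      then show ?thesis using power_mono[of 2 "exp y - inverse (exp y)" 2] by simp
    qed
    show ?thesis
    proof (cases "Im z \<ge> 0")
      case True
      then show ?thesis using *[of "Im z"] that by (simp add: S_def)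
    next
      case False
      then show ?thesis using *[of "- Im z"] that by (simp add: S_def exp_minus power2_commute)
    qed
  qed
  have "1 \<le> norm (cos z) ^ 2"
    using assms S \<open>S \<ge> 0\<close> by (auto simp: c intro: add_increasing)
  then show "cos z \<noteq> 0" by auto
  have "1 + S \<le> 4 * norm (cos z) ^ 2"
    using \<open>1 \<le> norm (cos z) ^ 2\<close> c S \<open>S \<ge> 0\<close> assms zero_le_power2[of "cos (Re z)"] by linarith
  with s have "norm (sin z) ^ 2 \<le> (2 * norm (cos z)) ^ 2"
    by (simp add: power_mult_distrib)
  then have "norm (sin z) \<le> 2 * norm (cos z)"
    by (rule power2_le_imp_le) simp
  then show "norm (tan z) \<le> 2"
    using \<open>cos z \<noteq> 0\<close> by (simp add: tan_def norm_divide field_simps)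
qed

subsection \<open>The contour integral\<close>

text \<open>Factored in the same way as \<open>integrand\<close>, so that for
  \<open>n \<le> m\<close> the value at 0 is the limit of
  \<open>tanh x ^ (m + 1) / x ^ (n + 1)\<close>.\<close>

definition real_integrand :: "nat \<Rightarrow> nat \<Rightarrow> real \<Rightarrow> real" where
  "real_integrand m n x = (if x = 0 then 1 else tanh x / x) ^ (n + 1) * tanh x ^ (m - n)"

lemma real_integrand_eq:
  assumes "x \<noteq> 0" "n \<le> m"
  shows "real_integrand m n x = tanh x ^ (m + 1) / x ^ (n + 1)"
  using assms by (simp add: real_integrand_def power_divide flip: power_add power_Suc)

lemma real_integrand_minus:
  assumes "even (m - n)"
  shows "real_integrand m n (- x) = real_integrand m n x"
  using assms by (simp add: real_integrand_def)

text \<open>Only the origin needs care: there \<open>tanh h / h\<close> tends to the derivative of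
  \<open>tanh\<close> at 0, which is 1.\<close>

lemma continuous_on_real_integrand: "continuous_on A (real_integrand m n)"
proof -
  have q: "continuous_on UNIV (\<lambda>x::real. if x = 0 then 1 else tanh x / x)"
    unfolding continuous_on_eq_continuous_at[OF open_UNIV]
  proof (intro ballI)
    fix x :: real
    show "isCont (\<lambda>x::real. if x = 0 then 1 else tanh x / x) x"
    proof (cases "x = 0")
      case True
      have "(tanh has_field_derivative 1) (at (0::real))"
        by (auto intro!: derivative_eq_intros)
      then have "(\<lambda>h::real. tanh h / h) \<midarrow>0\<rightarrow> 1"
        by (simp add: DERIV_def)
      then have "(\<lambda>h::real. if h = 0 then 1 else tanh h / h) \<midarrow>0\<rightarrow> 1"
        by (rule Lim_transform_eventually) (auto simp: eventually_at_filter)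
      then show ?thesis by (simp add: isCont_def True)
    next
      case False
      then have "isCont (\<lambda>x::real. tanh x / x) x"
        by (intro continuous_intros) auto
      moreover have "eventually (\<lambda>y. tanh y / y = (if y = 0 then 1 else tanh y / y)) (nhds x)"
        using t1_space_nhds[OF False] by eventually_elim auto
      ultimately show ?thesis by (subst (asm) isCont_cong)
    qed
  qed
  have "continuous_on UNIV (real_integrand m n)"
    unfolding real_integrand_def by (intro continuous_intros q) auto
  then show ?thesis using continuous_on_subset by blast
qed

text \<open>Since \<open>tan (i x) = i tanh x\<close>, the quotient \<open>tan_quot\<close> is real
  on this axis, and only the factor \<open>i ^ (m - n)\<close> remains.\<close>

lemma integrand_imaginary_axis:
  assumes "even (m - n)"
  shows "integrand m n (Complex 0 x) = (-1) ^ ((m - n) div 2) * of_real (real_integrand m n x)"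
proof -
  have "tanh (complex_of_real x) = of_real (tanh x)"
    by (simp add: tanh_def sinh_def cosh_def scaleR_conv_of_real exp_of_real exp_minus)
  then have t: "tan (Complex 0 x) = \<i> * of_real (tanh x)"
    by (simp add: Complex_eq tan_conv_tanh flip: mult.assoc)
  have q: "tan_quot (Complex 0 x) = of_real (if x = 0 then 1 else tanh x / x)"
    unfolding tan_quot_def t by (auto simp: Complex_eq)
  obtain k where k: "m - n = 2 * k" using assms by blast
  show ?thesis
    unfolding integrand_def real_integrand_def q t
    using power_minus[of "(complex_of_real (tanh x))\<^sup>2" k]
    by (auto simp: k power_mult_distrib power_mult)
qed

lemma integral_even:
  fixes f :: "real \<Rightarrow> real"
  assumes "continuous_on {-M..M} f" "\<And>x. f (- x) = f x" "M \<ge> 0"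
  shows "integral {-M..M} f = 2 * integral {0..M} f"
proof -
  have "integral {-M..M} f = integral {-M..0} f + integral {0..M} f"
    using assms by (intro Henstock_Kurzweil_Integration.integral_combine[symmetric] 
        integrable_continuous_interval) auto
  also have "integral {-M..0} f = integral {0..M} f"
    using Henstock_Kurzweil_Integration.integral_reflect_real[where f = f and a = 0 and b = M] by (simp add: assms)
  finally show ?thesis by simp
qed

lemma inside_tan_pole:
  assumes "k < N"
  shows "0 < Re (tan_pole k)" "Re (tan_pole k) < pi * real N" "Im (tan_pole k) = 0"
proof -
  have "real k + 1 / 2 < real N" using assms by linarith
  then show "Re (tan_pole k) < pi * real N" by (simp add: tan_pole_def)
qed (simp_all add: tan_pole_def add_nonneg_pos)

lemma contour_integral_integrand:
  assumes "n \<le> m" "even m" "N \<ge> 1"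
  defines "M \<equiv> pi * real N"
  shows "contour_integral (rectpath (Complex 0 (- M)) (Complex M M)) (integrand m n) =
           - 2 * pi * \<i> * (\<Sum>k<N. residue_sum m n (tan_pole k))"
proof -
  let ?a = "Complex 0 (-M)" and ?b = "Complex M M"
  \<comment> \<open>The strip exceeds the rectangle by 1 on the left and right. As
    \<open>pi / 2 > 1\<close>, the neighbouring zeros of \<open>cos\<close> at
    \<open>- pi / 2\<close> and \<open>M + pi / 2\<close> stay outside.\<close>
  let ?S = "{z. -1 < Re z} \<inter> {z. Re z < M + 1}"
  let ?P = "tan_pole ` {..<N}"
  have M: "M > 0" using assms by (simp add: M_def)
  have in_box: "tan_pole k \<in> box ?a ?b" if "k < N" for k
    using inside_tan_pole[OF that] M by (simp add: in_box_complex_iff M_def)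
  have inj: "inj_on tan_pole {..<N}"
    by (auto simp: inj_on_def tan_pole_def)
  have zeros: "cos z \<noteq> 0" if z: "z \<in> ?S - ?P" for z
  proof
    assume "cos z = 0"
    then obtain i :: int where "z = of_real (i * pi) + of_real pi / 2"
      unfolding cos_eq_0 by blast
    then have i: "z = of_real (pi * (real_of_int i + 1 / 2))" by (simp add: algebra_simps)
    have "i \<ge> 0"
    proof (rule ccontr)
      assume "\<not> i \<ge> 0"
      then have "pi * (real_of_int i + 1 / 2) \<le> pi * (- 1 / 2)" by (intro mult_left_mono) auto
      also have "\<dots> < -1" using pi_gt3 by simp
      finally show False using z i by simp
    qed
    moreover have "i < int N"
    proof (rule ccontr)
      assume "\<not> i < int N"
      then have "real N \<le> real_of_int i" by linarith
      then have "pi * (real_of_int i + 1 / 2) \<ge> pi * (real N + 1 / 2)" by (intro mult_left_mono) auto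
      moreover have "pi * (real N + 1 / 2) > M + 1" using pi_gt3 by (simp add: M_def algebra_simps)
      moreover have "Re z = pi * (real_of_int i + 1 / 2)" "Re z < M + 1" using z i by simp_all
      ultimately show False by linarith
    qed
    ultimately have "z = tan_pole (nat i)" "nat i < N" using i by (auto simp: tan_pole_def)
    then show False using z by blast
  qed
  have "contour_integral (rectpath ?a ?b) (integrand m n) = 2 * pi * \<i> *
          (\<Sum>p\<in>?P. winding_number (rectpath ?a ?b) p * residue (integrand m n) p)"
  proof (rule Residue_theorem[where S = ?S])
    show "open ?S" by (intro open_Int open_halfspace_Re_gt open_halfspace_Re_lt)
    show "connected ?S"
      by (intro convex_connected convex_Int convex_halfspace_Re_gt convex_halfspace_Re_lt)
    show "integrand m n holomorphic_on ?S - ?P"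
      by (rule holomorphic_on_subset[OF integrand_holomorphic]) (use zeros in blast)
    have img: "path_image (rectpath ?a ?b) = cbox ?a ?b - box ?a ?b"
      using M by (intro path_image_rectpath_cbox_minus_box) auto
    have cbox: "cbox ?a ?b \<subseteq> ?S" by (auto simp: in_cbox_complex_iff)
    show "path_image (rectpath ?a ?b) \<subseteq> ?S - ?P"
      using img cbox in_box by blast
    show "\<forall>z. z \<notin> ?S \<longrightarrow> winding_number (rectpath ?a ?b) z = 0"
      using M cbox by (intro allI impI winding_number_rectpath_outside) auto
  qed auto
  also have "(\<Sum>p\<in>?P. winding_number (rectpath ?a ?b) p * residue (integrand m n) p) =
      (\<Sum>k<N. winding_number (rectpath ?a ?b) (tan_pole k) * residue (integrand m n) (tan_pole k))"
    by (simp add: sum.reindex[OF inj])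
  also have "\<dots> = (\<Sum>k<N. - residue_sum m n (tan_pole k))"
    using in_box assms by (intro sum.cong refl) (simp add: winding_number_rectpath residue_integrand)
  finally show ?thesis by (simp add: sum_negf)
qed

lemma norm_integrand_le:
  assumes "n \<le> m" "norm z \<ge> R" "R > 0" "norm (tan z) \<le> 2"
  shows "norm (integrand m n z) \<le> 2 ^ (m + 1) / R ^ (n + 1)"
proof -
  have "z \<noteq> 0" using assms by auto
  then have "norm (integrand m n z) = norm (tan z) ^ (m + 1) / norm z ^ (n + 1)"
    using assms by (subst integrand_eq) (simp_all add: norm_divide norm_power norm_mult)
  also have "\<dots> \<le> 2 ^ (m + 1) / R ^ (n + 1)"
    using assms by (intro frac_le power_mono) auto
  finally show ?thesis .
qed

text \<open>The three sides off the imaginary axis have total length \<open>4 * M\<close>, and the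
  integrand is at most \<open>2 ^ (m + 1) / M ^ (n + 1)\<close> on them. Dividing by the norm of
  \<open>2 * \<i>\<close> gives the bound.\<close>

lemma truncated_integral_error:
  assumes "n \<le> m" "even m" "even n" "N \<ge> 1"
  defines "M \<equiv> pi * real N"
  shows "norm ((-1) ^ ((m - n) div 2) * of_real (integral {0..M} (real_integrand m n))
            - of_real pi * (\<Sum>k<N. residue_sum m n (tan_pole k))) \<le> 2 ^ (m + 2) / M ^ n"
proof -
  let ?f = "integrand m n"
  let ?a = "Complex 0 (-M)" and ?b = "Complex M (-M)" and ?c = "Complex M M" and ?d = "Complex 0 M"
  have M: "M \<ge> 3"
  proof -
    have "pi * real N \<ge> 3 * 1" using pi_gt3 assms by (intro mult_mono) auto
    then show ?thesis by (simp add: M_def)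
  qed
  \<comment> \<open>The right side lies over a multiple of pi, which is the first case of
    \<open>norm_tan_le_2\<close>; the horizontal sides fall under the second case because
    \<open>M \<ge> 3\<close>.\<close>
  have "cos M ^ 2 = 1"
    unfolding M_def by (simp add: mult.commute[of pi] cos_npi flip: power_mult)
  then have boundary: "cos z \<noteq> 0 \<and> norm (?f z) \<le> 2 ^ (m + 1) / M ^ (n + 1)"
    if "Re z = M \<or> \<bar>Im z\<bar> = M" for z
    using that norm_tan_le_2[of z] M abs_Re_le_cmod[of z] abs_Im_le_cmod[of z] assms
    by (intro conjI norm_integrand_le) auto
  have cont: "continuous_on A ?f" if "\<And>z. z \<in> A \<Longrightarrow> cos z \<noteq> 0" for A
    using holomorphic_on_subset[OF integrand_holomorphic] that holomorphic_on_imp_continuous_on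
    by blast
  have axis: "cos (Complex 0 x) \<noteq> 0" for x
  proof
    assume "cos (Complex 0 x) = 0"
    then obtain i :: int where "Complex 0 x = of_real (i * pi) + of_real pi / 2"
      unfolding cos_eq_0 by blast
    then have "0 = pi * (2 * real_of_int i + 1)" by (simp add: complex_eq_iff field_simps)
    then have "2 * i + 1 = 0" by (simp del: mult_eq_0_iff flip: of_int_eq_iff[where 'a = real])
    then show False by presburger
  qed
  have nonzero: "cos z \<noteq> 0" if "Re z = M \<or> \<bar>Im z\<bar> = M \<or> Re z = 0" for z
    using that boundary[of z] axis[of "Im z"] by (metis complex.collapse)
  have segs: "closed_segment ?a ?b \<subseteq> {z. Im z = -M}" "closed_segment ?b ?c \<subseteq> {z. Re z = M}"
       "closed_segment ?c ?d \<subseteq> {z. Im z = M}" "closed_segment ?d ?a \<subseteq> {z. Re z = 0}"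
    by (auto simp: closed_segment_same_Re closed_segment_same_Im)
  have int: "?f contour_integrable_on linepath ?a ?b" "?f contour_integrable_on linepath ?b ?c"
     "?f contour_integrable_on linepath ?c ?d" "?f contour_integrable_on linepath ?d ?a"
    by (rule contour_integrable_continuous_linepath, rule cont, rule nonzero,
        use segs M in \<open>auto simp: subset_iff\<close>)+
  let ?I = "\<lambda>a b. contour_integral (linepath a b) ?f"
  define J where "J = integral {0..M} (real_integrand m n)"
  \<comment> \<open>The rectangle is traversed counterclockwise, so its left side runs downward;
    reversing it gives an integral over \<open>{-M..M}\<close>, which evenness reduces to
    \<open>2 * J\<close>.\<close>
  have "?I ?d ?a = - ?I ?a ?d"
    by (rule contour_integral_reverse_linepath, rule cont, rule nonzero,
        use segs(4) in \<open>auto simp: subset_iff closed_segment_commute\<close>)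
  also have "?I ?a ?d = \<i> * integral {-M..M} (\<lambda>x. ?f (Complex 0 x))"
    using M by (intro contour_integral_linepath_same_Re) auto
  also have "(\<lambda>x. ?f (Complex 0 x)) = (\<lambda>x. (-1) ^ ((m - n) div 2) * of_real (real_integrand m n x))"
    using assms by (intro ext integrand_imaginary_axis) auto
  also have "integral {-M..M} \<dots> = (-1) ^ ((m - n) div 2) * of_real (integral {-M..M} (real_integrand m n))"
    using integral_linear[OF integrable_continuous_interval[OF continuous_on_real_integrand]
        bounded_linear_of_real, of "- M" M m n]
    by (simp add: o_def)
  also have "integral {-M..M} (real_integrand m n) = 2 * J"
    using assms M real_integrand_minus continuous_on_real_integrand
    by (subst integral_even) (auto simp: J_def)
  finally have da: "?I ?d ?a = - 2 * \<i> * ((-1) ^ ((m - n) div 2) * of_real J)"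
    by simp
  have "- 2 * pi * \<i> * (\<Sum>k<N. residue_sum m n (tan_pole k)) =
      contour_integral (rectpath ?a ?c) ?f"
    unfolding M_def using assms by (subst contour_integral_integrand) auto
  also have "\<dots> = ?I ?a ?b + (?I ?b ?c + (?I ?c ?d + ?I ?d ?a))"
    unfolding rectpath_def Let_def using int by simp
  finally have eq: "2 * \<i> * ((-1) ^ ((m - n) div 2) * of_real J - of_real pi * (\<Sum>k<N. residue_sum m n (tan_pole k)))
      = ?I ?a ?b + ?I ?b ?c + ?I ?c ?d"
    unfolding da by (simp add: algebra_simps)
  let ?B = "2 ^ (m + 1) / M ^ (n + 1)"
  have "norm (?I ?a ?b) \<le> ?B * norm (?b - ?a)" "norm (?I ?b ?c) \<le> ?B * norm (?c - ?b)"
       "norm (?I ?c ?d) \<le> ?B * norm (?d - ?c)"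
    using segs boundary M by (intro contour_integral_bound_linepath int; force)+
  then have le: "norm (?I ?a ?b + ?I ?b ?c + ?I ?c ?d) \<le> ?B * M + ?B * (2 * M) + ?B * M"
    using M by (intro norm_triangle_mono) (simp_all add: complex_diff norm_complex_def real_sqrt_mult)
  have "2 * norm ((-1) ^ ((m - n) div 2) * of_real J - of_real pi * (\<Sum>k<N. residue_sum m n (tan_pole k)))
      = norm (?I ?a ?b + ?I ?b ?c + ?I ?c ?d)"
    unfolding eq[symmetric] norm_mult by simp
  also have "\<dots> \<le> 2 * (2 ^ (m + 2) / M ^ n)"
    using le M by (simp add: field_simps)
  finally show ?thesis by (simp add: J_def)
qed

subsection \<open>Passage to the limit\<close>

lemma set_integrable_inverse_square: "set_integrable lborel {1..} (\<lambda>x::real. 1 / x ^ 2)"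
proof -
  have "(\<lambda>x::real. 1 / x ^ 2) integrable_on {1..}"
    using has_integral_inverse_power_to_inf[of 2 "1::real"] by (auto simp: has_integral_integrable)
  then have "(\<lambda>x::real. 1 / x ^ 2) absolutely_integrable_on {1..}"
    by (intro nonnegative_absolutely_integrable_1) auto
  then show ?thesis
    \<comment> \<open>Absolute integrability refers to the completed measure; Borel measurability
      carries it over to \<open>lborel\<close>.\<close>
    unfolding set_integrable_def by (subst (asm) integrable_completion) auto
qed

text \<open>Continuity settles \<open>{0..1}\<close>. On \<open>{1..}\<close> the bound
  \<open>\<bar>tanh x\<bar> \<le> 1\<close> and the exponent \<open>n + 1 \<ge> 2\<close> give the
  majorant \<open>1 / x ^ 2\<close>.\<close>

lemma set_integrable_real_integrand:
  assumes "n \<ge> 1" "n \<le> m"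
  shows "set_integrable lborel {0..} (real_integrand m n)"
proof -
  have "set_integrable lborel {1..} (real_integrand m n)"
  proof (rule set_integrable_bound[OF set_integrable_inverse_square])
    show "set_borel_measurable lborel {1..} (real_integrand m n)"
      unfolding set_borel_measurable_def
      using borel_measurable_continuous_onI[OF continuous_on_real_integrand] by simp
    have "norm (real_integrand m n x) \<le> 1 / x ^ 2" if "x \<ge> 1" for x
    proof -
      have "\<bar>tanh x\<bar> \<le> 1" using tanh_real_bounds[of x] by auto
      then have "\<bar>tanh x\<bar> ^ (m + 1) \<le> 1" by (intro power_le_one) auto
      moreover have "x ^ (n + 1) \<ge> x ^ 2" using that assms by (intro power_increasing) auto
      ultimately have "\<bar>tanh x\<bar> ^ (m + 1) / x ^ (n + 1) \<le> 1 / x ^ 2"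
        using that by (intro frac_le) auto
      then show ?thesis
        using that assms by (simp add: real_integrand_eq abs_mult power_abs)
    qed
    then show "AE x in lborel. x \<in> {1..} \<longrightarrow> norm (real_integrand m n x) \<le> norm (1 / x ^ 2)"
      by auto
  qed
  moreover have "set_integrable lborel {0..1} (real_integrand m n)"
    by (intro borel_integrable_atLeastAtMost' continuous_on_real_integrand)
  ultimately have "set_integrable lborel ({0..1} \<union> {1..}) (real_integrand m n)"
    by (intro set_integrable_Un) auto
  also have "{0..1} \<union> {1..} = {0::real..}" by auto
  finally show ?thesis .
qed

text \<open>For odd \<open>j\<close> the index \<open>m - j\<close> is odd and its coefficient
  vanishes. The remaining terms have sign 1 and are renumbered by
  \<open>n + j = 2 * p\<close>.\<close>

lemma residue_sum_even:
  assumes "even m" "even n" 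
  shows "residue_sum m n z = (\<Sum>p = n div 2..(m + n) div 2. of_nat (2 * p choose n) *
           fps_nth (ucot_fps ^ (m + 1)) (m + n - 2 * p) * (1 / z ^ (2 * p + 1)))"
proof -
  have "residue_sum m n z = (\<Sum>j\<in>{j. j \<le> m \<and> even j}. of_nat ((n + j) choose n) * (-1) ^ j / z ^ (n + j + 1) * 
     fps_nth (ucot_fps ^ (m + 1)) (m - j))"
    unfolding residue_sum_def using assms
    by (intro sum.mono_neutral_right) (auto simp del: power_Suc simp: ucot_fps_power_nth_odd)
  also have "\<dots> = (\<Sum>p = n div 2..(m + n) div 2. of_nat (2 * p choose n) *
           fps_nth (ucot_fps ^ (m + 1)) (m + n - 2 * p) * (1 / z ^ (2 * p + 1)))"
    using assms
    by (intro sum.reindex_bij_witness[where i = "\<lambda>p. 2 * p - n" and j = "\<lambda>j. (n + j) div 2"])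
       (auto elim!: evenE)
  finally show ?thesis .
qed

text \<open>The series over the poles is summed separately for each of the finitely many
  \<open>p\<close>. Since \<open>n\<close> is even and positive, \<open>p \<ge> 1\<close>, so each
  of these series converges. The factor pi lowers \<open>pi ^ (2 * p + 1)\<close> to
  \<open>pi ^ (2 * p)\<close>.\<close>

lemma residue_sum_sums:
  assumes "even m" "even n" "n \<ge> 1"
  shows "(\<lambda>k. of_real pi * residue_sum m n (tan_pole k)) sums
           (\<Sum>p = n div 2..(m + n) div 2. summand m n p)"
proof -
  have "(\<lambda>k. of_real pi * residue_sum m n (tan_pole k)) sums
     (of_real pi * (\<Sum>p = n div 2..(m + n) div 2. of_nat (2 * p choose n) *
           fps_nth (ucot_fps ^ (m + 1)) (m + n - 2 * p) * 
          ((2 ^ (2 * p + 1) - 1) * riemann_zeta (of_nat (2 * p + 1)) / of_real pi ^ (2 * p + 1))))"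
    unfolding residue_sum_even[OF assms(1,2)] using assms
    by (intro sums_mult sums_sum tan_pole_power_sums) (auto elim!: evenE)
  also have "of_real pi * (\<Sum>p = n div 2..(m + n) div 2. of_nat (2 * p choose n) *
           fps_nth (ucot_fps ^ (m + 1)) (m + n - 2 * p) * 
          ((2 ^ (2 * p + 1) - 1) * riemann_zeta (of_nat (2 * p + 1)) / of_real pi ^ (2 * p + 1))) =
      (\<Sum>p = n div 2..(m + n) div 2. summand m n p)"
    unfolding sum_distrib_left summand_def summand_coeff_def taylor_coeff_u_cot_power
    by (intro sum.cong refl) (simp add: field_simps)
  finally show ?thesis .
qed

lemma integral_real_integrand:
  assumes "n \<ge> 1" "n \<le> m" "even m" "even n"
  shows "complex_of_real (LBINT x:{0..}. real_integrand m n x) =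
           (-1) ^ ((m - n) div 2) * (\<Sum>p = n div 2..(m + n) div 2. summand m n p)"
proof -
  let ?s = "(-1) ^ ((m - n) div 2) :: complex"
  let ?h = "real_integrand m n"
  let ?R = "\<lambda>N. \<Sum>k<N. of_real pi * residue_sum m n (tan_pole k)"
  have lim: "filterlim (\<lambda>N. pi * real N) at_top sequentially"
    by (intro filterlim_tendsto_pos_mult_at_top[OF tendsto_const] filterlim_real_sequentially) simp
  have "((\<lambda>M. LBINT x:{0..M}. ?h x) \<longlongrightarrow> (LBINT x:{0..}. ?h x)) at_top"
    using set_integrable_real_integrand[of n m] assms
    by (intro tendsto_set_lebesgue_integral_at_top) auto
  \<comment> \<open>Integrability on the half-line is already known, so the limit may be taken along
    the truncation points \<open>pi * N\<close> of the contours.\<close>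
  then have "(\<lambda>N. LBINT x:{0..pi * real N}. ?h x) \<longlonglongrightarrow> (LBINT x:{0..}. ?h x)"
    using lim by (rule filterlim_compose)
  moreover have "(LBINT x:{0..M}. ?h x) = integral {0..M} ?h" for M
    by (intro set_borel_integral_eq_integral borel_integrable_atLeastAtMost' continuous_on_real_integrand)
  ultimately have "(\<lambda>N. integral {0..pi * real N} ?h) \<longlonglongrightarrow> (LBINT x:{0..}. ?h x)"
    by simp
  then have 1: "(\<lambda>N. ?s * of_real (integral {0..pi * real N} ?h) - ?R N) \<longlonglongrightarrow>
      ?s * of_real (LBINT x:{0..}. ?h x) - (\<Sum>p = n div 2..(m + n) div 2. summand m n p)"
    using residue_sum_sums[of m n] assms unfolding sums_def by (intro tendsto_intros) auto
  have 2: "(\<lambda>N. ?s * of_real (integral {0..pi * real N} ?h) - ?R N) \<longlonglongrightarrow> 0"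
  proof (rule Lim_null_comparison)
    show "eventually (\<lambda>N. norm (?s * of_real (integral {0..pi * real N} ?h) - ?R N) \<le>
        2 ^ (m + 2) / (pi * real N) ^ n) sequentially"
      using eventually_ge_at_top[of 1]
      by eventually_elim (use truncated_integral_error[of n m] assms in \<open>simp add: sum_distrib_left\<close>)
    show "(\<lambda>N. 2 ^ (m + 2) / (pi * real N) ^ n) \<longlonglongrightarrow> 0"
      using assms by (intro real_tendsto_divide_at_top[OF tendsto_const] filterlim_pow_at_top lim) auto
  qed
  have "?s * of_real (LBINT x:{0..}. ?h x) = (\<Sum>p = n div 2..(m + n) div 2. summand m n p)"
    using LIMSEQ_unique[OF 1 2] by simp
  then have "?s * (\<Sum>p = n div 2..(m + n) div 2. summand m n p) = (?s * ?s) * of_real (LBINT x:{0..}. ?h x)"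
    by (simp only: mult.assoc)
  also have "?s * ?s = 1"
    by (simp flip: power_mult_distrib)
  finally show ?thesis by simp
qed

section \<open>The first summand and the final statement\<close>

lemma taylor_coeff_u_cot_diag:
  assumes "even m"
  shows "taylor_coeff m (\<lambda>u. u_cot u ^ (m + 1)) = (-1) ^ (m div 2)"
  using assms ucot_fps_power_nth_diag unfolding taylor_coeff_u_cot_power by (auto elim!: evenE)

text \<open>At \<open>p = n / 2\<close> the binomial coefficient is 1 and the Taylor index is
  \<open>m\<close>, so the diagonal value \<open>(-1) ^ (m div 2)\<close> appears. Together with the
  global sign it becomes \<open>(-1) ^ (n div 2)\<close>, and \<open>m\<close> drops out.\<close>

lemma first_summand_coeff:
  assumes "even m" "even n" "n \<le> m"
  shows "(-1) ^ ((m - n) div 2) * summand_coeff m n (n div 2) =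
           (-1) ^ (n div 2) * (2 ^ (n + 1) - 1) / of_real pi ^ n"
proof -
  obtain a b where ab: "m = 2 * a" "n = 2 * b" using assms by (auto elim!: evenE)
  have sign: "(-1) ^ (a - b) * (-1) ^ a = ((-1) ^ b :: complex)"
    using assms by (auto simp: ab minus_one_power_iff)
  have "summand_coeff m n (n div 2) = (-1) ^ a * ((2 ^ (n + 1) - 1) / of_real pi ^ n)"
    using taylor_coeff_u_cot_diag[OF assms(1)] by (simp add: summand_coeff_def ab)
  then have "(-1) ^ ((m - n) div 2) * summand_coeff m n (n div 2) =
      ((-1) ^ (a - b) * (-1) ^ a) * ((2 ^ (n + 1) - 1) / of_real pi ^ n)"
    by (simp add: ab flip: diff_mult_distrib2)
  then show ?thesis
    unfolding sign by (simp add: ab)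
qed

theorem mainTheorem11:
  fixes m n :: nat
  assumes "m \<ge> 1" and "n \<ge> 1" and "m \<ge> n" and "even (m + n)" and "even n"
  shows "even m
    \<and> taylor_coeff m (\<lambda>u. u_cot u ^ (m + 1)) = (-1) ^ (m div 2)
    \<and> set_integrable lborel {0<..} (\<lambda>x::real. tanh x ^ (m + 1) / x ^ (n + 1))
    \<and> complex_of_real (LBINT x:{0<..}. tanh x ^ (m + 1) / x ^ (n + 1))
        = (-1) ^ ((m - n) div 2) * (\<Sum>p = n div 2..(m + n) div 2. summand m n p)
    \<and> (-1) ^ ((m - n) div 2) * summand m n (n div 2)
        = (-1) ^ (n div 2) * (2 ^ (n + 1) - 1)
            * riemann_zeta (of_nat (n + 1)) / of_real pi ^ n
    \<and> (\<forall>m'. m' \<ge> 1 \<and> m' \<ge> n \<and> even (m' + n) \<longrightarrow>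
          (-1) ^ ((m' - n) div 2) * summand_coeff m' n (n div 2)
            = (-1) ^ ((m - n) div 2) * summand_coeff m n (n div 2))"
proof (intro conjI allI impI)
  show m: "even m" using assms by simp
  then show "taylor_coeff m (\<lambda>u. u_cot u ^ (m + 1)) = (-1) ^ (m div 2)"
    by (rule taylor_coeff_u_cot_diag)
  let ?f = "\<lambda>x::real. tanh x ^ (m + 1) / x ^ (n + 1)"
  have f: "real_integrand m n x = ?f x" if "x \<in> {0<..}" for x
    using that assms by (intro real_integrand_eq) auto
  have "set_integrable lborel {0<..} (real_integrand m n)"
    by (rule set_integrable_subset[OF set_integrable_real_integrand]) (use assms in auto)
  then show "set_integrable lborel {0<..} ?f"
    by (subst (asm) set_integrable_cong[OF refl refl f])
  have "(LBINT x:{0<..}. ?f x) = (LBINT x:{0<..}. real_integrand m n x)"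
    using f by (intro set_lebesgue_integral_cong) auto
  \<comment> \<open>The two domains differ by the null set \<open>{0}\<close>.\<close>
  also have "\<dots> = (LBINT x:{0..}. real_integrand m n x)"
  proof (rule set_integral_cong_set)
    show "AE x in lborel. (x \<in> {0::real..}) = (x \<in> {0<..})"
      using AE_lborel_singleton[of "0::real"] by eventually_elim auto
  qed (use borel_measurable_continuous_onI[OF continuous_on_real_integrand] in
        \<open>auto simp: set_borel_measurable_def\<close>)
  finally show "complex_of_real (LBINT x:{0<..}. ?f x) =
      (-1) ^ ((m - n) div 2) * (\<Sum>p = n div 2..(m + n) div 2. summand m n p)"
    using integral_real_integrand[of n m] m assms by simp
  have "(-1) ^ ((m - n) div 2) * summand m n (n div 2) =
      ((-1) ^ ((m - n) div 2) * summand_coeff m n (n div 2)) * riemann_zeta (of_nat (n + 1))"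
    using assms by (simp add: summand_def)
  then show "(-1) ^ ((m - n) div 2) * summand m n (n div 2)
        = (-1) ^ (n div 2) * (2 ^ (n + 1) - 1)
            * riemann_zeta (of_nat (n + 1)) / of_real pi ^ n"
    using m assms by (subst (asm) first_summand_coeff) simp_all
next
  \<comment> \<open>As \<open>n\<close> is even, \<open>m'\<close> is even too, and both sides equal
    the same expression in \<open>n\<close> alone.\<close>
  fix m' assume "m' \<ge> 1 \<and> m' \<ge> n \<and> even (m' + n)"
  then show "(-1) ^ ((m' - n) div 2) * summand_coeff m' n (n div 2)
            = (-1) ^ ((m - n) div 2) * summand_coeff m n (n div 2)"
    using assms by (simp add: first_summand_coeff)
qed

end
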